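(* Let $C\subset\mathbb{H}_n$ be small and let $b_1,b_2,b_3,b_4\in\mathbb{H}_n$ be distinct, $\bar b=(b_1,b_2,b_3,b_4)$, such that $C$ induces a complete graph on $n-3$ vertices, every $b_i$ is adjacent to every element of $C$, and there are no edges among $b_1,\dots,b_4$. For $i<j$ let $\varphi_{i,j}(x,b_i,b_j)$ be the formula expressing that $x$ is adjacent to every element of $C\cup\{b_i,b_j\}$, and let $\varphi(x,\bar b)=\bigvee_{1\le i<j\le 4}\varphi_{i,j}(x,b_i,b_j)$. Then $\varphi(x,\bar b)$ forks over $C$ but does not divide over $C$ (with respect to $T_n$).
   Context: Fix $n\ge3$. Language $\{R\}$, $R$ the symmetric irreflexive edge relation. $T_n$ is the complete theory of the generic $K_n$-free (Henson) graph ($K_n$ the complete graph on $n$ vertices): the unique countable $K_n$-free graph into which every finite $K_n$-free graph embeds as an induced subgraph and in which every isomorphism between finite induced subgraphs extends to an automorphism. $\mathbb{H}_n$ is a sufficiently saturated monster model of $T_n$; "$C\subset\mathbb{H}_n$" means $C$ is small (finite here). Dividing: a partial type $\pi(\bar x,\bar b)$ divides over $C$ if there is a $C$-indiscernible sequence $(\bar b^l)_{l<\omega}$ with $\bar b^0=\bar b$ such that $\bigcup_l\pi(\bar x,\bar b^l)$ is inconsistent. Forking: $\pi(\bar x,\bar b)$ forks over $C$ if there is $D\supseteq\bar b\cup C$ such that every complete type over $D$ extending $\pi(\bar x,\bar b)$ divides over $C$. A formula forks/divides if the type consisting of it does. *)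

theory Defs
  imports Main
begin

section \<open>First-order formulas in the language of graphs\<close>

text \<open>
  Terms are variables (indexed by natural numbers) or constant symbols taken from a type
  \<open>'p\<close>. The constants never occur bound, so they serve both as names for elements of a
  model and as place holders for a tuple of parameters; substituting for them is the functorial map.
  The equality and edge symbols are the only predicate symbols.
\<close>

datatype (tpars: 'p) trm = Var nat | Par 'p

datatype (pars: 'p) fm =
    Bot
  | Eq "'p trm" "'p trm"
  | Adj "'p trm" "'p trm"
  | Neg "'p fm"
  | Conj "'p fm" "'p fm"
  | Ex nat "'p fm"
  for map: map_pars

primrec tvars :: "'p trm \<Rightarrow> nat set" where
  "tvars (Var x) = {x}"
| "tvars (Par p) = {}"

primrec fv :: "'p fm \<Rightarrow> nat set" where
  "fv Bot = {}"
| "fv (Eq s t) = tvars s \<union> tvars t"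
| "fv (Adj s t) = tvars s \<union> tvars t"
| "fv (Neg \<phi>) = fv \<phi>"
| "fv (Conj \<phi> \<psi>) = fv \<phi> \<union> fv \<psi>"
| "fv (Ex x \<phi>) = fv \<phi> - {x}"

primrec val :: "('p \<Rightarrow> 'a) \<Rightarrow> (nat \<Rightarrow> 'a) \<Rightarrow> 'p trm \<Rightarrow> 'a" where
  "val \<rho> e (Var x) = e x"
| "val \<rho> e (Par p) = \<rho> p"

text \<open>
  A structure is a binary relation \<open>R\<close> on a type \<open>'a\<close>, whose universe is the whole type;
  \<open>\<rho>\<close> interprets the constants and \<open>e\<close> the variables.
\<close>

primrec sat :: "('a \<Rightarrow> 'a \<Rightarrow> bool) \<Rightarrow> ('p \<Rightarrow> 'a) \<Rightarrow> (nat \<Rightarrow> 'a) \<Rightarrow> 'p fm \<Rightarrow> bool" where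
  "sat R \<rho> e Bot \<longleftrightarrow> False"
| "sat R \<rho> e (Eq s t) \<longleftrightarrow> val \<rho> e s = val \<rho> e t"
| "sat R \<rho> e (Adj s t) \<longleftrightarrow> R (val \<rho> e s) (val \<rho> e t)"
| "sat R \<rho> e (Neg \<phi>) \<longleftrightarrow> \<not> sat R \<rho> e \<phi>"
| "sat R \<rho> e (Conj \<phi> \<psi>) \<longleftrightarrow> sat R \<rho> e \<phi> \<and> sat R \<rho> e \<psi>"
| "sat R \<rho> e (Ex x \<phi>) \<longleftrightarrow> (\<exists>a. sat R \<rho> (e(x := a)) \<phi>)"

definition Disj :: "'p fm \<Rightarrow> 'p fm \<Rightarrow> 'p fm" where
  "Disj \<phi> \<psi> = Neg (Conj (Neg \<phi>) (Neg \<psi>))"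

definition conj_list :: "'p fm list \<Rightarrow> 'p fm" where
  "conj_list \<phi>s = foldr Conj \<phi>s (Neg Bot)"

definition disj_list :: "'p fm list \<Rightarrow> 'p fm" where
  "disj_list \<phi>s = foldr Disj \<phi>s Bot"

text \<open>The conjunction of a finite set of formulas, in some fixed order.\<close>

definition conj_set :: "'p fm set \<Rightarrow> 'p fm" where
  "conj_set F = conj_list (SOME \<phi>s. set \<phi>s = F \<and> distinct \<phi>s)"


section \<open>Theories, types and monster models\<close>

text \<open>Sentences of the pure language are the closed formulas without constants; the type
  \<open>unit\<close> of constants is therefore irrelevant here.\<close>

definition sentence :: "unit fm \<Rightarrow> bool" where
  "sentence \<sigma> \<longleftrightarrow> pars \<sigma> = {} \<and> fv \<sigma> = {}"

definition theory_of :: "('a \<Rightarrow> 'a \<Rightarrow> bool) \<Rightarrow> unit fm set" where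
  "theory_of R = {\<sigma>. sentence \<sigma> \<and> (\<forall>\<rho> e. sat R \<rho> e \<sigma>)}"

definition models :: "('a \<Rightarrow> 'a \<Rightarrow> bool) \<Rightarrow> unit fm set \<Rightarrow> bool" where
  "models R T \<longleftrightarrow> (\<forall>\<sigma>\<in>T. \<forall>\<rho> e. sat R \<rho> e \<sigma>)"

text \<open>Formulas with parameters in \<open>A\<close> and free variables in \<open>X\<close>.\<close>

definition formulas_over :: "'p set \<Rightarrow> nat set \<Rightarrow> 'p fm set" where
  "formulas_over A X = {\<phi>. pars \<phi> \<subseteq> A \<and> fv \<phi> \<subseteq> X}"

text \<open>
  Consistency of a set of formulas with parameters in the model \<open>R\<close> (that is, consistency with
  the elementary diagram of \<open>R\<close>) is finite satisfiability in \<open>R\<close>.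
\<close>

definition consistent :: "('a \<Rightarrow> 'a \<Rightarrow> bool) \<Rightarrow> 'a fm set \<Rightarrow> bool" where
  "consistent R \<pi> \<longleftrightarrow> (\<forall>F. F \<subseteq> \<pi> \<and> finite F \<longrightarrow> (\<exists>e. \<forall>\<phi>\<in>F. sat R id e \<phi>))"

definition complete_type :: "('a \<Rightarrow> 'a \<Rightarrow> bool) \<Rightarrow> 'a set \<Rightarrow> nat set \<Rightarrow> 'a fm set \<Rightarrow> bool" where
  "complete_type R A X p \<longleftrightarrow>
     p \<subseteq> formulas_over A X \<and> consistent R p \<and>
     (\<forall>\<phi>\<in>formulas_over A X. \<phi> \<in> p \<or> Neg \<phi> \<in> p)"

definition small :: "'k rel \<Rightarrow> 'a set \<Rightarrow> bool" where
  "small \<kappa> A \<longleftrightarrow> (card_of A, \<kappa>) \<in> ordLess"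

definition saturated :: "'k rel \<Rightarrow> ('a \<Rightarrow> 'a \<Rightarrow> bool) \<Rightarrow> bool" where
  "saturated \<kappa> R \<longleftrightarrow>
     (\<forall>A p. small \<kappa> A \<and> complete_type R A {0} p \<longrightarrow>
        (\<exists>e. \<forall>\<phi>\<in>p. sat R id e \<phi>))"

definition automorphism :: "('a \<Rightarrow> 'a \<Rightarrow> bool) \<Rightarrow> ('a \<Rightarrow> 'a) \<Rightarrow> bool" where
  "automorphism R g \<longleftrightarrow> bij g \<and> (\<forall>x y. R (g x) (g y) \<longleftrightarrow> R x y)"

definition elementary_on :: "('a \<Rightarrow> 'a \<Rightarrow> bool) \<Rightarrow> 'a set \<Rightarrow> ('a \<Rightarrow> 'a) \<Rightarrow> bool" where
  "elementary_on R A f \<longleftrightarrow>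
     (\<forall>\<phi>\<in>formulas_over A {}. \<forall>e. sat R id e \<phi> \<longleftrightarrow> sat R f e \<phi>)"

definition strongly_homogeneous :: "'k rel \<Rightarrow> ('a \<Rightarrow> 'a \<Rightarrow> bool) \<Rightarrow> bool" where
  "strongly_homogeneous \<kappa> R \<longleftrightarrow>
     (\<forall>A f. small \<kappa> A \<and> elementary_on R A f \<longrightarrow>
        (\<exists>g. automorphism R g \<and> (\<forall>a\<in>A. g a = f a)))"

definition monster_model :: "'k rel \<Rightarrow> unit fm set \<Rightarrow> ('a \<Rightarrow> 'a \<Rightarrow> bool) \<Rightarrow> bool" where
  "monster_model \<kappa> T R \<longleftrightarrow>
     Card_order \<kappa> \<and> (natLeq, \<kappa>) \<in> ordLess \<and>
     models R T \<and> saturated \<kappa> R \<and> strongly_homogeneous \<kappa> R"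


section \<open>Dividing and forking\<close>

text \<open>
  A formula over \<open>C\<close> in the variables \<open>x\<close> and a tuple of variables \<open>y\<close> indexed by \<open>I\<close> is
  rendered with constants of sum type: \<open>Inl c\<close> names the element \<open>c\<close> of \<open>C\<close> and \<open>Inr i\<close> stands
  for \<open>y\<^sub>i\<close>. The index type is arbitrary, so tuples may be infinite.
\<close>

definition inst :: "('i \<Rightarrow> 'a) \<Rightarrow> ('a + 'i) fm \<Rightarrow> 'a fm" where
  "inst b = map_pars (case_sum id b)"

text \<open>
  Indiscernibility over \<open>C\<close> of a sequence of \<open>I\<close>-indexed tuples. The constant \<open>Inr (k, i)\<close> stands
  for the \<open>i\<close>-th entry of the \<open>k\<close>-th tuple variable of \<open>\<psi>\<close>. As \<open>\<psi>\<close> has only finitely many tuple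
  variables, finite increasing sequences of indices may be replaced by infinite ones.
\<close>

definition indiscernible ::
    "('a \<Rightarrow> 'a \<Rightarrow> bool) \<Rightarrow> 'a set \<Rightarrow> 'i set \<Rightarrow> (nat \<Rightarrow> 'i \<Rightarrow> 'a) \<Rightarrow> bool" where
  "indiscernible R C I f \<longleftrightarrow>
     (\<forall>\<psi> \<in> formulas_over (Inl ` C \<union> Inr ` (UNIV \<times> I)) {}.
        \<forall>s t :: nat \<Rightarrow> nat. strict_mono s \<and> strict_mono t \<longrightarrow>
          (\<forall>e. sat R id e (inst (\<lambda>(k, i). f (s k) i) \<psi>) \<longleftrightarrow>
               sat R id e (inst (\<lambda>(k, i). f (t k) i) \<psi>)))"

text \<open>\<open>divides R C I b \<pi>\<close>: the partial type \<open>\<pi>(x, b)\<close> divides over \<open>C\<close>, where \<open>b\<close> is a tuple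
  indexed by \<open>I\<close>.\<close>

definition divides ::
    "('a \<Rightarrow> 'a \<Rightarrow> bool) \<Rightarrow> 'a set \<Rightarrow> 'i set \<Rightarrow> ('i \<Rightarrow> 'a) \<Rightarrow> ('a + 'i) fm set \<Rightarrow> bool" where
  "divides R C I b \<pi> \<longleftrightarrow>
     (\<exists>f. (\<forall>i\<in>I. f 0 i = b i) \<and> indiscernible R C I f \<and>
          \<not> consistent R (\<Union>l. inst (f l) ` \<pi>))"

text \<open>
  \<open>forks R \<kappa> C X I b \<pi>\<close>: the partial type \<open>\<pi>(x, b)\<close> in the variables \<open>X\<close> forks over \<open>C\<close>. A type
  \<open>p\<close> over \<open>D\<close> is regarded as \<open>p(x, d)\<close> where \<open>d\<close> is the enumeration of \<open>D\<close> by itself.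
\<close>

definition forks ::
    "('a \<Rightarrow> 'a \<Rightarrow> bool) \<Rightarrow> 'k rel \<Rightarrow> 'a set \<Rightarrow> nat set \<Rightarrow> 'i set \<Rightarrow> ('i \<Rightarrow> 'a) \<Rightarrow>
     ('a + 'i) fm set \<Rightarrow> bool" where
  "forks R \<kappa> C X I b \<pi> \<longleftrightarrow>
     (\<exists>D. b ` I \<union> C \<subseteq> D \<and> small \<kappa> D \<and>
        (\<forall>p. complete_type R D X p \<and> inst b ` \<pi> \<subseteq> p \<longrightarrow>
             divides R C D (\<lambda>d. d) (map_pars Inr ` p)))"


section \<open>The generic \<open>K\<^sub>n\<close>-free graph\<close>

definition clique :: "('a \<Rightarrow> 'a \<Rightarrow> bool) \<Rightarrow> 'a set \<Rightarrow> bool" where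
  "clique R S \<longleftrightarrow> (\<forall>x\<in>S. \<forall>y\<in>S. x \<noteq> y \<longrightarrow> R x y)"

definition Kn_free_graph_on :: "nat \<Rightarrow> 'a set \<Rightarrow> ('a \<Rightarrow> 'a \<Rightarrow> bool) \<Rightarrow> bool" where
  "Kn_free_graph_on n V R \<longleftrightarrow>
     symp_on V R \<and> irreflp_on V R \<and>
     \<not> (\<exists>S\<subseteq>V. finite S \<and> card S = n \<and> clique R S)"

text \<open>Countability is built in by taking the natural numbers as vertices; a graph that embeds every
  finite \<open>K\<^sub>n\<close>-free graph is infinite (for \<open>n \<ge> 2\<close>), so this loses no generality.\<close>

definition generic_Kn_free_graph :: "nat \<Rightarrow> (nat \<Rightarrow> nat \<Rightarrow> bool) \<Rightarrow> bool" where
  "generic_Kn_free_graph n E \<longleftrightarrow>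
     Kn_free_graph_on n UNIV E \<and>
     (\<forall>(V :: nat set) F. finite V \<and> Kn_free_graph_on n V F \<longrightarrow>
        (\<exists>h. inj_on h V \<and> (\<forall>x\<in>V. \<forall>y\<in>V. E (h x) (h y) \<longleftrightarrow> F x y))) \<and>
     (\<forall>A h. finite A \<and> inj_on h A \<and> (\<forall>x\<in>A. \<forall>y\<in>A. E (h x) (h y) \<longleftrightarrow> E x y) \<longrightarrow>
        (\<exists>g. automorphism E g \<and> (\<forall>x\<in>A. g x = h x)))"


section \<open>The formula\<close>

text \<open>The free variable \<open>x\<close> is \<open>Var 0\<close>, and \<open>Inr i\<close> stands for \<open>b\<^sub>i\<close>.\<close>

definition phi_pair :: "'a set \<Rightarrow> nat \<Rightarrow> nat \<Rightarrow> ('a + nat) fm" where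
  "phi_pair C i j = conj_set ((\<lambda>p. Adj (Var 0) (Par p)) ` (Inl ` C \<union> {Inr i, Inr j}))"

definition phi :: "'a set \<Rightarrow> ('a + nat) fm" where
  "phi C = disj_list [phi_pair C i j. i \<leftarrow> [1..<5], j \<leftarrow> [Suc i..<5]]"

lemma sat_conj_list [simp]: "sat R \<rho> e (conj_list \<phi>s) \<longleftrightarrow> (\<forall>\<phi>\<in>set \<phi>s. sat R \<rho> e \<phi>)"
  by (induction \<phi>s) (auto simp: conj_list_def)

lemma sat_disj_list [simp]: "sat R \<rho> e (disj_list \<phi>s) \<longleftrightarrow> (\<exists>\<phi>\<in>set \<phi>s. sat R \<rho> e \<phi>)"
  by (induction \<phi>s) (auto simp: disj_list_def Disj_def)

lemma sat_conj_set:
  assumes "finite F"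
  shows "sat R \<rho> e (conj_set F) \<longleftrightarrow> (\<forall>\<phi>\<in>F. sat R \<rho> e \<phi>)"
proof -
  have "set (SOME \<phi>s. set \<phi>s = F \<and> distinct \<phi>s) = F"
    using someI_ex[OF finite_distinct_list[OF assms]] by blast
  then show ?thesis
    by (simp add: conj_set_def)
qed

lemma val_map_trm: "val \<rho> e (map_trm g t) = val (\<rho> \<circ> g) e t"
  by (cases t) auto

lemma sat_map_pars: "sat R \<rho> e (map_pars g \<phi>) \<longleftrightarrow> sat R (\<rho> \<circ> g) e \<phi>"
  by (induction \<phi> arbitrary: e) (auto simp: val_map_trm)

lemma sat_phi:
  assumes "finite C"
  shows "sat R id e (inst b (phi C)) \<longleftrightarrow>
    (\<exists>i j. 1 \<le> i \<and> i < j \<and> j \<le> 4 \<and> (\<forall>c \<in> C \<union> {b i, b j}. R (e 0) c))"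
proof -
  have pair: "sat R (case_sum id b) e (phi_pair C i j) \<longleftrightarrow> (\<forall>c \<in> C \<union> {b i, b j}. R (e 0) c)" for i j
    using assms by (simp add: phi_pair_def sat_conj_set ball_Un)
  have "sat R id e (inst b (phi C)) \<longleftrightarrow>
    (\<exists>i\<in>{1..<5}. \<exists>j\<in>{Suc i..<5}. sat R (case_sum id b) e (phi_pair C i j))"
    unfolding inst_def sat_map_pars phi_def sat_disj_list set_concat set_map set_upt id_comp
    by (simp del: upt_rec_numeral upt_Suc)
  also have "\<dots> \<longleftrightarrow> (\<exists>i j. (i \<in> {1..<5} \<and> j \<in> {Suc i..<5}) \<and> (\<forall>c \<in> C \<union> {b i, b j}. R (e 0) c))"
    unfolding pair by blast
  also have "\<dots> \<longleftrightarrow> (\<exists>i j. (1 \<le> i \<and> i < j \<and> j \<le> 4) \<and> (\<forall>c \<in> C \<union> {b i, b j}. R (e 0) c))"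
  proof -
    have "(i \<in> {1..<5} \<and> j \<in> {Suc i..<5}) = (1 \<le> i \<and> i < j \<and> j \<le> 4)" for i j :: nat
      by (simp, linarith)
    then show ?thesis
      by (simp only:)
  qed
  finally show ?thesis
    by (simp only: conj_assoc)
qed

end

theory Submission
  imports Defs "HOL-Library.Countable_Set"
begin

text \<open>
  The countable generic graph is \<open>K\<^sub>n\<close>-free and realises every one-point extension of a finite
  subgraph that creates no \<open>K\<^sub>n\<close>. Both are first-order properties, so the monster model has them too.
  Back and forth then gives quantifier elimination, so indiscernibility only concerns equalities and
  edges.

  Forking: a complete type over \<open>D = C \<union> {b\<^sub>1, \<dots>, b\<^sub>4}\<close> containing \<open>\<phi>\<close> contains some
  \<open>\<phi>\<^bsub>i,j\<^esub>\<close>. Keep the rest of \<open>D\<close> fixed and move \<open>b\<^sub>i\<close>, \<open>b\<^sub>j\<close> along an indiscernible sequence with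
  \<open>b\<^sub>i\<^sup>l\<close> adjacent to \<open>b\<^sub>j\<^sup>m\<close> exactly for \<open>l \<noteq> m\<close>; a common realisation of two instances would be in a
  \<open>K\<^sub>n\<close> together with \<open>C\<close>, \<open>b\<^sub>i\<^sup>0\<close> and \<open>b\<^sub>j\<^sup>1\<close>.

  Not dividing: given an indiscernible sequence, write \<open>i \<rightarrow> j\<close> if \<open>b\<^sub>i\<^sup>0\<close> is adjacent to \<open>b\<^sub>j\<^sup>1\<close>. If every
  pair \<open>i \<noteq> j\<close> were related in some direction, then four indices would contain a transitive triple
  \<open>i \<rightarrow> j \<rightarrow> k\<close>, \<open>i \<rightarrow> k\<close>, and \<open>b\<^sub>i\<^sup>0\<close>, \<open>b\<^sub>j\<^sup>1\<close>, \<open>b\<^sub>k\<^sup>2\<close> would form a \<open>K\<^sub>n\<close> with \<open>C\<close>. So for some pair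
  \<open>i < j\<close> all the \<open>b\<^sub>i\<^sup>l\<close>, \<open>b\<^sub>j\<^sup>l\<close> are pairwise non-adjacent, and they have a common neighbour with \<open>C\<close>.
\<close>

section \<open>Formulas\<close>

lemma finite_pars [simp]: "finite (pars \<phi>)"
proof -
  have "finite (tpars t)" for t :: "'p trm"
    by (cases t) auto
  then show ?thesis
    by (induction \<phi>) auto
qed

lemma finite_fv [simp]: "finite (fv \<phi>)"
proof -
  have "finite (tvars t)" for t :: "'p trm"
    by (cases t) auto
  then show ?thesis
    by (induction \<phi>) auto
qed

lemma pars_conj_list: "pars (conj_list \<phi>s) = (\<Union>\<phi>\<in>set \<phi>s. pars \<phi>)"
  by (induction \<phi>s) (auto simp: conj_list_def)

lemma pars_disj_list: "pars (disj_list \<phi>s) = (\<Union>\<phi>\<in>set \<phi>s. pars \<phi>)"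
  by (induction \<phi>s) (auto simp: disj_list_def Disj_def)

lemma fv_disj_list: "fv (disj_list \<phi>s) = (\<Union>\<phi>\<in>set \<phi>s. fv \<phi>)"
  by (induction \<phi>s) (auto simp: disj_list_def Disj_def)

lemma map_pars_disj_list: "map_pars g (disj_list \<phi>s) = disj_list (map (map_pars g) \<phi>s)"
  by (induction \<phi>s) (auto simp: disj_list_def Disj_def)

lemma sat_inst: "sat R \<rho> e (inst b \<phi>) \<longleftrightarrow> sat R (\<rho> \<circ> case_sum id b) e \<phi>"
  by (simp add: inst_def sat_map_pars)

lemma complete_type_disj_list:
  assumes p: "complete_type R A X p" and mem: "disj_list \<phi>s \<in> p"
  shows "\<exists>\<phi>\<in>set \<phi>s. \<phi> \<in> p"
proof (rule ccontr)
  assume none: "\<not> (\<exists>\<phi>\<in>set \<phi>s. \<phi> \<in> p)"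
  have "disj_list \<phi>s \<in> formulas_over A X"
    using p mem by (auto simp: complete_type_def)
  then have "set \<phi>s \<subseteq> formulas_over A X"
    by (auto simp: formulas_over_def pars_disj_list fv_disj_list)
  then have "insert (disj_list \<phi>s) (Neg ` set \<phi>s) \<subseteq> p"
    using p none mem by (auto simp: complete_type_def)
  moreover have "finite (insert (disj_list \<phi>s) (Neg ` set \<phi>s))"
    by simp
  ultimately obtain e where e: "\<forall>\<phi>\<in>insert (disj_list \<phi>s) (Neg ` set \<phi>s). sat R id e \<phi>"
    using p unfolding complete_type_def consistent_def by meson
  then have "sat R id e (disj_list \<phi>s)" "\<forall>\<phi>\<in>set \<phi>s. \<not> sat R id e \<phi>"
    by auto
  then show False
    by simp
qed

primrec exs :: "nat \<Rightarrow> 'p fm \<Rightarrow> 'p fm" where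
  "exs 0 \<phi> = \<phi>"
| "exs (Suc N) \<phi> = exs N (Ex N \<phi>)"

lemma fv_exs [simp]: "fv (exs N \<phi>) = fv \<phi> - {..<N}"
  by (induction N arbitrary: \<phi>) (auto simp: lessThan_Suc)

lemma pars_exs [simp]: "pars (exs N \<phi>) = pars \<phi>"
  by (induction N arbitrary: \<phi>) auto

lemma sat_exsI: "sat R \<rho> e \<phi> \<Longrightarrow> sat R \<rho> e (exs N \<phi>)"
proof (induction N arbitrary: \<phi>)
  case (Suc N)
  have "sat R \<rho> e (Ex N \<phi>)"
    using Suc.prems by (auto intro!: exI[of _ "e N"])
  then show ?case
    using Suc.IH by simp
qed simp

lemma sat_exsD: "sat R \<rho> e (exs N \<phi>) \<Longrightarrow> \<exists>e'. sat R \<rho> e' \<phi>"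
proof (induction N arbitrary: \<phi>)
  case (Suc N)
  then obtain e' where "sat R \<rho> e' (Ex N \<phi>)"
    by fastforce
  then show ?case
    by auto
qed auto

lemma valid_if_models_theory_of:
  fixes \<phi> :: "unit fm"
  assumes "models R (theory_of H)" and "pars \<phi> = {}" and "\<And>\<rho> e. sat H \<rho> e \<phi>"
  shows "sat R \<rho> e \<phi>"
proof -
  obtain N where "fv \<phi> \<subseteq> {..<N}"
    using finite_nat_iff_bounded[of "fv \<phi>"] by auto
  then have "sentence (Neg (exs N (Neg \<phi>)))"
    using assms(2) by (auto simp: sentence_def)
  moreover have "sat H \<rho> e (Neg (exs N (Neg \<phi>)))" for \<rho> e
    using assms(3) sat_exsD[of H \<rho> e N "Neg \<phi>"] by auto
  ultimately have "sat R \<rho> e (Neg (exs N (Neg \<phi>)))"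
    using assms(1) by (auto simp: theory_of_def models_def)
  then show ?thesis
    using sat_exsI[of R \<rho> e "Neg \<phi>" N] by auto
qed

section \<open>Quantifier-free types\<close>

definition same_qf_type ::
    "'i set \<Rightarrow> ('a \<Rightarrow> 'a \<Rightarrow> bool) \<Rightarrow> ('i \<Rightarrow> 'a) \<Rightarrow> ('b \<Rightarrow> 'b \<Rightarrow> bool) \<Rightarrow> ('i \<Rightarrow> 'b) \<Rightarrow> bool" where
  "same_qf_type I R x S y \<longleftrightarrow>
     (\<forall>i\<in>I. \<forall>j\<in>I. (x i = x j \<longleftrightarrow> y i = y j) \<and> (R (x i) (x j) \<longleftrightarrow> S (y i) (y j)))"

lemma same_qf_type_eq_iff:
  "same_qf_type I R x S y \<Longrightarrow> i \<in> I \<Longrightarrow> j \<in> I \<Longrightarrow> x i = x j \<longleftrightarrow> y i = y j"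
  by (simp add: same_qf_type_def)

lemma same_qf_type_edge_iff:
  "same_qf_type I R x S y \<Longrightarrow> i \<in> I \<Longrightarrow> j \<in> I \<Longrightarrow> R (x i) (x j) \<longleftrightarrow> S (y i) (y j)"
  by (simp add: same_qf_type_def)

lemma same_qf_type_commute: "same_qf_type I R x S y \<longleftrightarrow> same_qf_type I S y R x"
  by (auto simp: same_qf_type_def)

lemma same_qf_type_subset: "same_qf_type I R x S y \<Longrightarrow> J \<subseteq> I \<Longrightarrow> same_qf_type J R x S y"
  by (auto simp: same_qf_type_def)

lemma same_qf_type_cong:
  assumes "\<And>i. i \<in> I \<Longrightarrow> y i = y' i"
  shows "same_qf_type I R x S y \<longleftrightarrow> same_qf_type I R x S y'"
  using assms by (simp add: same_qf_type_def)

lemma same_qf_type_UN_chain: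
  assumes J: "mono J" "\<And>k :: nat. same_qf_type (J k) R x S y"
  shows "same_qf_type (\<Union>k. J k) R x S y"
  unfolding same_qf_type_def
proof (intro ballI)
  fix i j assume "i \<in> (\<Union>k. J k)" "j \<in> (\<Union>k. J k)"
  then obtain k l where "i \<in> J k" "j \<in> J l"
    by blast
  then have "i \<in> J (max k l)" "j \<in> J (max k l)"
    using monoD[OF J(1), of k "max k l"] monoD[OF J(1), of l "max k l"] by auto
  then show "(x i = x j \<longleftrightarrow> y i = y j) \<and> (R (x i) (x j) \<longleftrightarrow> S (y i) (y j))"
    using J(2)[of "max k l"] by (simp add: same_qf_type_def)
qed

lemma same_qf_type_insert_iff:
  assumes "i \<notin> I"
  shows "same_qf_type (insert i I) R (x(i := a)) S (y(i := b)) \<longleftrightarrow>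
    same_qf_type I R x S y \<and> (R a a \<longleftrightarrow> S b b) \<and>
    (\<forall>j\<in>I. (a = x j \<longleftrightarrow> b = y j) \<and> (R a (x j) \<longleftrightarrow> S b (y j)) \<and> (R (x j) a \<longleftrightarrow> S (y j) b))"
proof -
  have "j \<noteq> i" if "j \<in> I" for j
    using assms that by blast
  then show ?thesis
    unfolding same_qf_type_def by (simp add: eq_commute[of _ a] eq_commute[of _ b]) blast
qed

lemma same_qf_type_clique_iff:
  assumes "same_qf_type I R x S y"
  shows "clique R (x ` I) \<longleftrightarrow> clique S (y ` I)"
  using assms by (auto simp: same_qf_type_def clique_def)

lemma same_qf_type_card_image:
  assumes "same_qf_type I R x S y"
  shows "card (x ` I) = card (y ` I)"
proof -
  let ?G = "(\<lambda>i. (x i, y i)) ` I"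
  have "inj_on fst ?G" "inj_on snd ?G"
    using assms by (auto simp: same_qf_type_def inj_on_def)
  then have "card (fst ` ?G) = card (snd ` ?G)"
    by (simp add: card_image)
  then show ?thesis
    by (simp add: image_image)
qed

definition literal :: "bool \<Rightarrow> 'p fm \<Rightarrow> 'p fm" where
  "literal P \<phi> = (if P then \<phi> else Neg \<phi>)"

lemma sat_literal [simp]: "sat R \<rho> e (literal P \<phi>) \<longleftrightarrow> (sat R \<rho> e \<phi> \<longleftrightarrow> P)"
  by (simp add: literal_def)

lemma pars_literal [simp]: "pars (literal P \<phi>) = pars \<phi>"
  by (simp add: literal_def)

definition diagram :: "('a \<Rightarrow> 'a \<Rightarrow> bool) \<Rightarrow> (nat \<Rightarrow> 'a) \<Rightarrow> nat \<Rightarrow> 'p fm" where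
  "diagram R x N = conj_list
     [Conj (literal (x i = x j) (Eq (Var i) (Var j))) (literal (R (x i) (x j)) (Adj (Var i) (Var j))).
       i \<leftarrow> [0..<N], j \<leftarrow> [0..<N]]"

lemma pars_diagram [simp]: "pars (diagram R x N) = {}"
  by (auto simp: diagram_def pars_conj_list)

lemma sat_diagram [simp]: "sat S \<rho> e (diagram R x N) \<longleftrightarrow> same_qf_type {..<N} R x S e"
  by (auto simp: diagram_def same_qf_type_def)

definition one_point_extension :: "nat set \<Rightarrow> nat \<Rightarrow> 'p fm" where
  "one_point_extension J N = Ex N (conj_list
     [Conj (Neg (Eq (Var N) (Var i))) (literal (i \<in> J) (Adj (Var N) (Var i))). i \<leftarrow> [0..<N]])"

lemma pars_one_point_extension [simp]: "pars (one_point_extension J N) = {}"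
  by (auto simp: one_point_extension_def pars_conj_list)

lemma sat_one_point_extension [simp]:
  "sat R \<rho> e (one_point_extension J N) \<longleftrightarrow> (\<exists>a. \<forall>i<N. a \<noteq> e i \<and> (R a (e i) \<longleftrightarrow> i \<in> J))"
  by (simp add: one_point_extension_def atLeast0LessThan lessThan_def)

lemma qf_type_realised:
  fixes R :: "'a \<Rightarrow> 'a \<Rightarrow> bool" and x :: "nat \<Rightarrow> 'a"
  assumes "models R (theory_of H)"
  obtains y where "same_qf_type {..<N} R x H y"
proof -
  have "\<exists>y. same_qf_type {..<N} R x H y"
  proof (rule ccontr)
    assume "\<not> (\<exists>y. same_qf_type {..<N} R x H y)"
    then have "sat R (undefined :: unit \<Rightarrow> 'a) x (Neg (diagram R x N))"
      by (intro valid_if_models_theory_of[OF assms]) simp_all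
    then show False
      by (simp add: same_qf_type_def)
  qed
  then show thesis
    using that by blast
qed

lemma one_point_extension_transfer:
  fixes R :: "'a \<Rightarrow> 'a \<Rightarrow> bool" and x :: "nat \<Rightarrow> 'a"
  assumes "models R (theory_of H)"
    and "\<And>y. same_qf_type {..<N} R x H y \<Longrightarrow> \<exists>b. \<forall>i<N. b \<noteq> y i \<and> (H b (y i) \<longleftrightarrow> i \<in> J)"
  shows "\<exists>a. \<forall>i<N. a \<noteq> x i \<and> (R a (x i) \<longleftrightarrow> i \<in> J)"
proof -
  have "sat R (undefined :: unit \<Rightarrow> 'a) x (Neg (Conj (diagram R x N) (Neg (one_point_extension J N))))"
    by (rule valid_if_models_theory_of[OF assms(1)]) (use assms(2) in simp_all)
  then show ?thesis
    by (simp add: same_qf_type_def)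
qed

section \<open>Graphs with the one-point extension property\<close>

locale Kn_free_graph =
  fixes n :: nat and R :: "'a \<Rightarrow> 'a \<Rightarrow> bool"
  assumes Kn_free: "Kn_free_graph_on n UNIV R"
begin

lemma sym: "R x y \<Longrightarrow> R y x"
  using Kn_free by (auto simp: Kn_free_graph_on_def dest: sympD)

lemma irrefl: "\<not> R x x"
  using Kn_free by (auto simp: Kn_free_graph_on_def dest: irreflpD)

lemma card_clique_neq: "finite S \<Longrightarrow> clique R S \<Longrightarrow> card S \<noteq> n"
  using Kn_free by (auto simp: Kn_free_graph_on_def)

lemma card_joined_cliques_neq:
  assumes "finite T" "clique R T" and "finite C" "clique R C"
    and joined: "\<And>t c. t \<in> T \<Longrightarrow> c \<in> C \<Longrightarrow> R t c"
  shows "card T + card C \<noteq> n"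
proof -
  have "T \<inter> C = {}"
    using joined irrefl by blast
  then have "card (T \<union> C) = card T + card C"
    using assms(1,3) by (simp add: card_Un_disjoint)
  moreover have "clique R (T \<union> C)"
    using assms(2,4) joined sym unfolding clique_def by blast
  ultimately show ?thesis
    using card_clique_neq[of "T \<union> C"] assms(1,3) by simp
qed

lemma no_triangle_joined_to_clique:
  assumes "finite C" "clique R C" "n = card C + 3"
    and "R x y" "R y z" "R x z" and "\<And>c. c \<in> C \<Longrightarrow> R x c \<and> R y c \<and> R z c"
  shows False
proof -
  have "x \<noteq> y" "y \<noteq> z" "x \<noteq> z"
    using assms(4-6) irrefl by blast+
  then have "card {x, y, z} = 3"
    by simp
  moreover have "clique R {x, y, z}"
    using assms(4-6) sym by (auto simp: clique_def)
  ultimately show False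
    using card_joined_cliques_neq[of "{x, y, z}" C] assms(1-3,7) by auto
qed

end

locale Kn_free_extension = Kn_free_graph +
  assumes extension: "finite A \<Longrightarrow> U \<subseteq> A \<Longrightarrow> (\<And>S. S \<subseteq> U \<Longrightarrow> clique R S \<Longrightarrow> Suc (card S) \<noteq> n) \<Longrightarrow>
    \<exists>x. x \<notin> A \<and> (\<forall>a\<in>A. R x a \<longleftrightarrow> a \<in> U)"
begin

lemma extension_along_same_qf_type:
  assumes "finite I" and xy: "same_qf_type I F x R y"
    and U: "\<And>S. S \<subseteq> U \<inter> x ` I \<Longrightarrow> clique F S \<Longrightarrow> Suc (card S) \<noteq> n"
  shows "\<exists>b. \<forall>i\<in>I. b \<noteq> y i \<and> (R b (y i) \<longleftrightarrow> x i \<in> U)"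
proof -
  define J where "J = {i \<in> I. x i \<in> U}"
  have "\<exists>b. b \<notin> y ` I \<and> (\<forall>a\<in>y ` I. R b a \<longleftrightarrow> a \<in> y ` J)"
  proof (rule extension)
    show "finite (y ` I)" "y ` J \<subseteq> y ` I"
      using assms(1) by (auto simp: J_def)
    fix S assume "S \<subseteq> y ` J" "clique R S"
    then obtain K where K: "K \<subseteq> J" "S = y ` K"
      by (auto simp: subset_image_iff)
    then have "same_qf_type K F x R y"
      using same_qf_type_subset[OF xy, of K] by (auto simp: J_def)
    then have "clique F (x ` K)" "card (x ` K) = card S"
      using \<open>clique R S\<close> K(2) by (simp_all add: same_qf_type_clique_iff same_qf_type_card_image)
    moreover have "x ` K \<subseteq> U \<inter> x ` I"
      using K(1) by (auto simp: J_def)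
    ultimately show "Suc (card S) \<noteq> n"
      using U by metis
  qed
  moreover have "y i \<in> y ` J \<longleftrightarrow> x i \<in> U" if "i \<in> I" for i
    using that same_qf_type_eq_iff[OF xy that] by (force simp: J_def)
  ultimately show ?thesis
    by auto
qed

text \<open>
  With \<open>F = R\<close> this is the back-and-forth step of quantifier elimination; with other graphs \<open>F\<close> it
  builds embeddings into \<open>R\<close>.
\<close>

lemma same_qf_type_extend:
  assumes F: "Kn_free_graph_on n V F" and "finite I" "i \<notin> I" "x ` I \<subseteq> V" "a \<in> V"
    and xy: "same_qf_type I F x R y"
  shows "\<exists>b. same_qf_type (insert i I) F (x(i := a)) R (y(i := b))"
proof (cases "a \<in> x ` I")
  case True
  then obtain j where "j \<in> I" "a = x j"
    by blast
  then have "same_qf_type (insert i I) F (x(i := a)) R (y(i := y j))"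
    using xy by (auto simp: same_qf_type_insert_iff[OF assms(3)] same_qf_type_def)
  then show ?thesis ..
next
  case False
  have F_sym: "F c d \<Longrightarrow> F d c" and F_irrefl: "\<not> F c c" if "c \<in> V" "d \<in> V" for c d
    using F that by (auto simp: Kn_free_graph_on_def dest: symp_onD irreflp_onD)
  have "Suc (card S) \<noteq> n" if S: "S \<subseteq> {c. F a c} \<inter> x ` I" "clique F S" for S
  proof -
    have "insert a S \<subseteq> V" "finite (insert a S)" "a \<notin> S"
      using S(1) assms(2,4,5) False by (auto intro: finite_subset)
    moreover have "clique F (insert a S)"
      using S assms(4,5) F_sym unfolding clique_def by blast
    ultimately show ?thesis
      using F by (force simp: Kn_free_graph_on_def)
  qed
  then obtain b where b: "\<And>j. j \<in> I \<Longrightarrow> b \<noteq> y j \<and> (R b (y j) \<longleftrightarrow> F a (x j))"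
    using extension_along_same_qf_type[OF assms(2) xy, of "{c. F a c}"] by auto
  have "F (x j) a \<longleftrightarrow> R (y j) b" if "j \<in> I" for j
    using b[OF that] that assms(4,5) F_sym sym by blast
  then have "same_qf_type (insert i I) F (x(i := a)) R (y(i := b))"
    using xy b False F_irrefl[OF assms(5,5)] irrefl
    by (auto simp: same_qf_type_insert_iff[OF assms(3)])
  then show ?thesis ..
qed

end

section \<open>The monster model has the one-point extension property\<close>

definition adjoin_vertex :: "('a \<Rightarrow> 'a \<Rightarrow> bool) \<Rightarrow> 'a \<Rightarrow> 'a set \<Rightarrow> 'a \<Rightarrow> 'a \<Rightarrow> bool" where
  "adjoin_vertex R v U x y \<longleftrightarrow> (if x = v then y \<in> U else if y = v then x \<in> U else R x y)"

lemma Kn_free_adjoin_vertex: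
  assumes R: "Kn_free_graph_on n V R" and "v \<notin> V" "U \<subseteq> V"
    and U: "\<And>S. S \<subseteq> U \<Longrightarrow> clique R S \<Longrightarrow> Suc (card S) \<noteq> n"
  shows "Kn_free_graph_on n (insert v V) (adjoin_vertex R v U)"
  unfolding Kn_free_graph_on_def
proof (intro conjI notI)
  show "symp_on (insert v V) (adjoin_vertex R v U)" "irreflp_on (insert v V) (adjoin_vertex R v U)"
    using assms by (auto simp: Kn_free_graph_on_def adjoin_vertex_def symp_on_def irreflp_on_def)
  assume "\<exists>S\<subseteq>insert v V. finite S \<and> card S = n \<and> clique (adjoin_vertex R v U) S"
  then obtain S where S: "S \<subseteq> insert v V" "finite S" "card S = n" "clique (adjoin_vertex R v U) S"
    by blast
  then have clique: "clique R (S - {v})"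
    by (auto simp: clique_def adjoin_vertex_def)
  show False
  proof (cases "v \<in> S")
    case True
    then have "adjoin_vertex R v U v x" if "x \<in> S - {v}" for x
      using S(4) that by (auto simp: clique_def)
    then have "S - {v} \<subseteq> U"
      by (auto simp: adjoin_vertex_def)
    then show False
      using U clique S(2,3) True by (metis card.remove)
  next
    case False
    then show False
      using R S clique by (auto simp: Kn_free_graph_on_def)
  qed
qed

lemma generic_embeds_over:
  assumes generic: "generic_Kn_free_graph n H"
    and V: "finite V" "Kn_free_graph_on n V F" and A: "A \<subseteq> V" "\<And>a c. a \<in> A \<Longrightarrow> c \<in> A \<Longrightarrow> F a c \<longleftrightarrow> H a c"
  obtains h where "inj_on h V" "\<And>a. a \<in> A \<Longrightarrow> h a = a"
    "\<And>x y. x \<in> V \<Longrightarrow> y \<in> V \<Longrightarrow> H (h x) (h y) \<longleftrightarrow> F x y"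
proof -
  have "\<exists>h. inj_on h V \<and> (\<forall>x\<in>V. \<forall>y\<in>V. H (h x) (h y) \<longleftrightarrow> F x y)"
    using generic V by (simp add: generic_Kn_free_graph_def)
  then obtain h where h: "inj_on h V" "\<And>x y. x \<in> V \<Longrightarrow> y \<in> V \<Longrightarrow> H (h x) (h y) \<longleftrightarrow> F x y"
    by blast
  have inv_h: "inv_into A h (h a) = a" if "a \<in> A" for a
    using inj_on_subset[OF h(1) A(1)] that by simp
  have "\<forall>x\<in>h ` A. \<forall>y\<in>h ` A. H (inv_into A h x) (inv_into A h y) \<longleftrightarrow> H x y"
    using h(2) A by (auto simp: inv_h subset_iff)
  moreover have "finite (h ` A)" "inj_on (inv_into A h) (h ` A)"
    using V(1) A(1) by (auto intro: finite_subset inj_on_inv_into)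
  ultimately have "\<exists>g. automorphism H g \<and> (\<forall>x\<in>h ` A. g x = inv_into A h x)"
    using generic by (simp add: generic_Kn_free_graph_def del: ball_simps)
  then obtain g where g: "automorphism H g" "\<And>x. x \<in> h ` A \<Longrightarrow> g x = inv_into A h x"
    by blast
  show thesis
  proof
    have "inj g"
      using g(1) by (simp add: automorphism_def bij_def)
    then show "inj_on (g \<circ> h) V"
      using h(1) by (auto intro: comp_inj_on inj_on_subset)
    show "(g \<circ> h) a = a" if "a \<in> A" for a
      using g(2) inv_h that by simp
    show "H ((g \<circ> h) x) ((g \<circ> h) y) \<longleftrightarrow> F x y" if "x \<in> V" "y \<in> V" for x y
      using g(1) h(2) that by (simp add: automorphism_def)
  qed
qed

lemma Kn_free_extension_if_generic:
  assumes generic: "generic_Kn_free_graph n H"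
  shows "Kn_free_extension n H"
proof
  show H: "Kn_free_graph_on n UNIV H"
    using generic unfolding generic_Kn_free_graph_def by (rule conjunct1)
  fix A U :: "nat set"
  assume A: "finite A" "U \<subseteq> A" and U: "\<And>S. S \<subseteq> U \<Longrightarrow> clique H S \<Longrightarrow> Suc (card S) \<noteq> n"
  obtain v where v: "v \<notin> A"
    using A(1) ex_new_if_finite infinite_UNIV_nat by blast
  let ?F = "adjoin_vertex H v U"
  have "Kn_free_graph_on n (insert v A) ?F"
    using H A(2) v U by (intro Kn_free_adjoin_vertex) (auto simp: Kn_free_graph_on_def symp_on_def irreflp_on_def)
  moreover have "?F a c \<longleftrightarrow> H a c" if "a \<in> A" "c \<in> A" for a c
    using that v by (auto simp: adjoin_vertex_def)
  ultimately obtain h where h: "inj_on h (insert v A)" "\<And>a. a \<in> A \<Longrightarrow> h a = a"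
      "\<And>x y. x \<in> insert v A \<Longrightarrow> y \<in> insert v A \<Longrightarrow> H (h x) (h y) \<longleftrightarrow> ?F x y"
    using generic_embeds_over[OF generic, of "insert v A" ?F A] A(1) by blast
  have "h v \<notin> A"
  proof
    assume "h v \<in> A"
    moreover from this have "h v = v"
      using inj_onD[OF h(1), of "h v" v] h(2) by simp
    ultimately show False
      using v by simp
  qed
  moreover have "H (h v) a \<longleftrightarrow> a \<in> U" if "a \<in> A" for a
    using h(3)[of v a] h(2) that by (simp add: adjoin_vertex_def)
  ultimately show "\<exists>x. x \<notin> A \<and> (\<forall>a\<in>A. H x a \<longleftrightarrow> a \<in> U)"
    by blast
qed

lemma Kn_free_graph_if_elementarily_equivalent:
  assumes "Kn_free_graph n H" and mod: "models R (theory_of H)"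
  shows "Kn_free_graph n R"
proof
  interpret H: Kn_free_graph n H
    by (fact assms(1))
  show "Kn_free_graph_on n UNIV R"
    unfolding Kn_free_graph_on_def
  proof (intro conjI notI)
    show "symp R"
    proof (rule sympI)
      fix a b assume "R a b"
      obtain y where "same_qf_type {..<2 :: nat} R (\<lambda>i. if i = 0 then a else b) H y"
        using qf_type_realised[OF mod] .
      from same_qf_type_edge_iff[OF this, of 0 1] same_qf_type_edge_iff[OF this, of 1 0]
      show "R b a"
        using \<open>R a b\<close> H.sym by simp
    qed
    show "irreflp R"
    proof (rule irreflpI)
      fix a
      obtain y where "same_qf_type {..<1 :: nat} R (\<lambda>_. a) H y"
        using qf_type_realised[OF mod] .
      from same_qf_type_edge_iff[OF this, of 0 0] show "\<not> R a a"
        using H.irrefl by simp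
    qed
    assume "\<exists>S\<subseteq>UNIV. finite S \<and> card S = n \<and> clique R S"
    then obtain S where S: "finite S" "card S = n" "clique R S"
      by blast
    then obtain x where x: "S = x ` {..<n}"
      using ex_bij_betw_nat_finite[of S] by (auto simp: atLeast0LessThan bij_betw_def)
    obtain y where y: "same_qf_type {..<n} R x H y"
      using qf_type_realised[OF mod] .
    then have "clique H (y ` {..<n})" "card (y ` {..<n}) = n"
      using S(2,3) x by (auto simp: same_qf_type_clique_iff same_qf_type_card_image)
    then show False
      using H.card_clique_neq by blast
  qed
qed

lemma Kn_free_extension_if_elementarily_equivalent:
  assumes "Kn_free_extension n H" and mod: "models R (theory_of H)"
  shows "Kn_free_extension n R"
proof -
  interpret H: Kn_free_extension n H
    by (fact assms(1))
  interpret Kn_free_graph n R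
    using H.Kn_free_graph_axioms mod by (rule Kn_free_graph_if_elementarily_equivalent)
  show ?thesis
  proof
    fix A U assume "finite A" "U \<subseteq> A" and U: "\<And>S. S \<subseteq> U \<Longrightarrow> clique R S \<Longrightarrow> Suc (card S) \<noteq> n"
    obtain x and N :: nat where x: "A = x ` {i. i < N}"
      using \<open>finite A\<close> by (auto simp: finite_conv_nat_seg_image)
    have "\<exists>b. \<forall>i<N. b \<noteq> y i \<and> (H b (y i) \<longleftrightarrow> i \<in> {i. x i \<in> U})" if "same_qf_type {..<N} R x H y" for y
      using H.extension_along_same_qf_type[OF _ that, of U] U by auto
    then obtain a where "\<forall>i<N. a \<noteq> x i \<and> (R a (x i) \<longleftrightarrow> i \<in> {i. x i \<in> U})"
      using one_point_extension_transfer[OF mod] by blast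
    then show "\<exists>a. a \<notin> A \<and> (\<forall>c\<in>A. R a c \<longleftrightarrow> c \<in> U)"
      by (auto simp: x)
  qed
qed

section \<open>Quantifier elimination and embeddings of countable graphs\<close>

definition free_terms :: "'p fm \<Rightarrow> 'p trm set" where
  "free_terms \<phi> = Par ` pars \<phi> \<union> Var ` fv \<phi>"

lemma finite_free_terms: "finite (free_terms \<phi>)"
  by (simp add: free_terms_def)

lemma free_terms_simps:
  "free_terms (Eq s t) = {s, t}" "free_terms (Adj s t) = {s, t}" "free_terms (Neg \<phi>) = free_terms \<phi>"
  by (cases s; cases t; auto simp: free_terms_def)+

lemma val_fun_upd: "val \<rho> (e(x := a)) = (val \<rho> e)(Var x := a)"
proof
  show "val \<rho> (e(x := a)) t = ((val \<rho> e)(Var x := a)) t" for t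
    by (cases t) auto
qed

context Kn_free_extension
begin

lemma sat_iff_if_same_qf_type:
  assumes "same_qf_type (free_terms \<phi>) R (val \<rho> e) R (val \<rho>' e')"
  shows "sat R \<rho> e \<phi> \<longleftrightarrow> sat R \<rho>' e' \<phi>"
  using assms
proof (induction \<phi> arbitrary: \<rho> e \<rho>' e')
  case (Conj \<phi> \<psi>)
  have "free_terms \<phi> \<subseteq> free_terms (Conj \<phi> \<psi>)" "free_terms \<psi> \<subseteq> free_terms (Conj \<phi> \<psi>)"
    by (auto simp: free_terms_def)
  then show ?case
    using Conj same_qf_type_subset by (metis sat.simps(5))
next
  case (Ex x \<phi>)
  let ?T = "free_terms (Ex x \<phi>)"
  have forth: "sat R \<sigma>' d' (Ex x \<phi>)"
    if type: "same_qf_type ?T R (val \<sigma> d) R (val \<sigma>' d')" and sat: "sat R \<sigma> d (Ex x \<phi>)" for \<sigma> d \<sigma>' d'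
  proof -
    obtain a where a: "sat R \<sigma> (d(x := a)) \<phi>"
      using sat by auto
    obtain b where "same_qf_type (insert (Var x) ?T) R (val \<sigma> (d(x := a))) R (val \<sigma>' (d'(x := b)))"
      using same_qf_type_extend[OF Kn_free finite_free_terms _ _ _ type, of "Var x" a]
      by (auto simp: val_fun_upd free_terms_def)
    then have "same_qf_type (free_terms \<phi>) R (val \<sigma> (d(x := a))) R (val \<sigma>' (d'(x := b)))"
      by (rule same_qf_type_subset) (auto simp: free_terms_def)
    from iffD1[OF Ex.IH[OF this] a] show ?thesis
      unfolding sat.simps ..
  qed
  show ?case
    using forth Ex.prems same_qf_type_commute by blast
qed (simp_all add: free_terms_simps same_qf_type_def)

lemma same_qf_type_extend_sequence_step:
  fixes v :: "nat \<Rightarrow> 'c" and z :: "nat \<Rightarrow> 'a"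
  assumes F: "Kn_free_graph_on n V F" and I: "finite I" "x ` I \<subseteq> V" and v: "range v \<subseteq> V"
    and xy: "same_qf_type (Inl ` I \<union> Inr ` {..<k}) F (case_sum x v) R (case_sum y z)"
  shows "\<exists>r. same_qf_type (Inl ` I \<union> Inr ` {..<Suc k}) F (case_sum x v) R (case_sum y (z(k := r)))"
proof -
  let ?J = "Inl ` I \<union> Inr ` {..<k}"
  have J: "finite ?J" "Inr k \<notin> ?J" "case_sum x v ` ?J \<subseteq> V" "v k \<in> V"
    using I v by auto
  obtain r where
    "same_qf_type (insert (Inr k) ?J) F ((case_sum x v)(Inr k := v k)) R ((case_sum y z)(Inr k := r))"
    using same_qf_type_extend[OF F J xy] by blast
  moreover have "(case_sum x v)(Inr k := v k) = case_sum x v"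
    by (rule fun_upd_idem) simp
  moreover have "(case_sum y z)(Inr k := r) = case_sum y (z(k := r))"
    by (auto simp: fun_eq_iff split: sum.split)
  moreover have "insert (Inr k) ?J = Inl ` I \<union> Inr ` {..<Suc k}"
    by (auto simp: lessThan_Suc)
  ultimately show ?thesis
    by metis
qed

lemma same_qf_type_extend_sequence:
  assumes F: "Kn_free_graph_on n V F" and I: "finite I" "x ` I \<subseteq> V" and v: "range v \<subseteq> V"
    and xy: "same_qf_type I F x R y"
  obtains z :: "nat \<Rightarrow> 'a"
    where "same_qf_type (Inl ` I \<union> range Inr) F (case_sum x v) R (case_sum y z)"
proof -
  define J where "J k = Inl ` I \<union> Inr ` {..<k}" for k :: nat
  define P where "P z k r \<longleftrightarrow> same_qf_type (J (Suc k)) F (case_sum x v) R (case_sum y (z(k := r)))"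
    for z k r
  have "\<exists>z. \<forall>k. P z k (z k)"
  proof (rule dependent_wellorder_choice)
    show "P z k r = P z' k r" if "\<And>m. m < k \<Longrightarrow> z m = z' m" for z z' k r
      unfolding P_def using that by (intro same_qf_type_cong) (auto simp: J_def less_Suc_eq)
    fix k z assume z: "\<And>m. m < k \<Longrightarrow> P z m (z m)"
    have "same_qf_type (J k) F (case_sum x v) R (case_sum y z)"
    proof (cases k)
      case 0
      then show ?thesis
        using xy by (auto simp: J_def same_qf_type_def)
    next
      case (Suc m)
      then show ?thesis
        using z[of m] by (simp add: P_def)
    qed
    then show "\<exists>r. P z k r"
      unfolding P_def J_def by (rule same_qf_type_extend_sequence_step[OF F I v])
  qed
  then obtain z where "\<And>k. same_qf_type (J (Suc k)) F (case_sum x v) R (case_sum y z)"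
    by (auto simp: P_def)
  moreover have "mono (\<lambda>k. J (Suc k))"
    by (intro monoI) (auto simp: J_def)
  ultimately have "same_qf_type (\<Union>k. J (Suc k)) F (case_sum x v) R (case_sum y z)"
    by (intro same_qf_type_UN_chain)
  moreover have "(\<Union>k. J (Suc k)) = Inl ` I \<union> range Inr"
    by (auto simp: J_def)
  ultimately show thesis
    using that by simp
qed

lemma embedding_extends_to_countable:
  assumes F: "Kn_free_graph_on n V F" "countable V" and I: "finite I" "I \<subseteq> V"
    and y: "same_qf_type I F id R y"
  obtains z where "\<And>i. i \<in> I \<Longrightarrow> z i = y i" "same_qf_type V F id R z"
proof (cases "V = {}")
  case True
  then show thesis
    using that[of y] I by (simp add: same_qf_type_def)
next
  case False
  have range: "range (from_nat_into V) \<subseteq> V"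
    using False by (simp add: range_from_nat_into_subset)
  obtain z where z: "same_qf_type (Inl ` I \<union> range Inr) F (case_sum id (from_nat_into V)) R (case_sum y z)"
    using same_qf_type_extend_sequence[OF F(1) I(1) _ range y] I(2) by auto
  define index where "index i = (if i \<in> I then Inl i else Inr (to_nat_on V i))" for i
  have "index i \<in> Inl ` I \<union> range Inr" for i
    by (simp add: index_def)
  moreover have "case_sum id (from_nat_into V) (index i) = i" if "i \<in> V" for i
    using F(2) that by (simp add: index_def)
  ultimately have "same_qf_type V F id R (\<lambda>i. case_sum y z (index i))"
    using z unfolding same_qf_type_def by (metis id_apply)
  moreover have "case_sum y z (index i) = y i" if "i \<in> I" for i
    using that by (simp add: index_def)
  ultimately show thesis
    by (rule that[rotated])
qed

end

section \<open>Indiscernible sequences\<close>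

definition entry_names :: "'a set \<Rightarrow> 'i set \<Rightarrow> ('a + nat \<times> 'i) set" where
  "entry_names C I = Inl ` C \<union> Inr ` (UNIV \<times> I)"

definition entry_val :: "(nat \<Rightarrow> 'i \<Rightarrow> 'a) \<Rightarrow> (nat \<Rightarrow> nat) \<Rightarrow> 'a + nat \<times> 'i \<Rightarrow> 'a" where
  "entry_val f s = case_sum id (\<lambda>(k, i). f (s k) i)"

lemma entry_val_simps [simp]:
  "entry_val f s (Inl c) = c" "entry_val f s (Inr (k, i)) = f (s k) i"
  by (simp_all add: entry_val_def)

lemma indiscernible_iff_sat:
  "indiscernible R C I f \<longleftrightarrow> (\<forall>\<psi>\<in>formulas_over (entry_names C I) {}. \<forall>s t.
     strict_mono s \<and> strict_mono t \<longrightarrow> (\<forall>e. sat R (entry_val f s) e \<psi> \<longleftrightarrow> sat R (entry_val f t) e \<psi>))"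
  unfolding indiscernible_def sat_inst id_comp entry_names_def entry_val_def ..

lemma indiscernible_same_qf_type:
  assumes ind: "indiscernible R C I f" and st: "strict_mono s" "strict_mono t"
  shows "same_qf_type (entry_names C I) R (entry_val f s) R (entry_val f t)"
  unfolding same_qf_type_def
proof (intro ballI)
  fix p q assume "p \<in> entry_names C I" "q \<in> entry_names C I"
  then have atoms: "Eq (Par p) (Par q) \<in> formulas_over (entry_names C I) {}"
      "Adj (Par p) (Par q) \<in> formulas_over (entry_names C I) {}"
    by (simp_all add: formulas_over_def)
  have same_sat: "sat R (entry_val f s) e \<psi> \<longleftrightarrow> sat R (entry_val f t) e \<psi>"
    if "\<psi> \<in> formulas_over (entry_names C I) {}" for \<psi> e
    using bspec[OF ind[unfolded indiscernible_iff_sat] that] st by blast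
  from atoms[THEN same_sat]
  show "(entry_val f s p = entry_val f s q \<longleftrightarrow> entry_val f t p = entry_val f t q) \<and>
      (R (entry_val f s p) (entry_val f s q) \<longleftrightarrow> R (entry_val f t p) (entry_val f t q))"
    by simp
qed

lemma indiscernible_edge_base:
  assumes ind: "indiscernible R C I f" and "i \<in> I" "c \<in> C"
  shows "R (f l i) c \<longleftrightarrow> R (f m i) c"
proof -
  have "strict_mono (\<lambda>k. l + k)" "strict_mono (\<lambda>k. m + k)"
    by (simp_all add: strict_mono_def)
  from same_qf_type_edge_iff[OF indiscernible_same_qf_type[OF ind this], of "Inr (0, i)" "Inl c"]
  show ?thesis
    using assms(2,3) by (simp add: entry_names_def)
qed

lemma indiscernible_edge_same:
  assumes ind: "indiscernible R C I f" and "i \<in> I" "j \<in> I"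
  shows "R (f l i) (f l j) \<longleftrightarrow> R (f m i) (f m j)"
proof -
  have "strict_mono (\<lambda>k. l + k)" "strict_mono (\<lambda>k. m + k)"
    by (simp_all add: strict_mono_def)
  from same_qf_type_edge_iff[OF indiscernible_same_qf_type[OF ind this], of "Inr (0, i)" "Inr (0, j)"]
  show ?thesis
    using assms(2,3) by (simp add: entry_names_def)
qed

lemma indiscernible_edge_less:
  assumes ind: "indiscernible R C I f" and "i \<in> I" "j \<in> I" and "l < m" "l' < m'"
  shows "R (f l i) (f m j) \<longleftrightarrow> R (f l' i) (f m' j)"
proof -
  have "strict_mono (\<lambda>k. l + k * (m - l))" "strict_mono (\<lambda>k. l' + k * (m' - l'))"
    using assms(4,5) by (simp_all add: strict_mono_def)
  from same_qf_type_edge_iff[OF indiscernible_same_qf_type[OF ind this], of "Inr (0, i)" "Inr (1, j)"]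
  show ?thesis
    using assms(2-5) by (simp add: entry_names_def)
qed

context Kn_free_extension
begin

lemma indiscernible_if_same_qf_type:
  assumes same_type: "\<And>s t. strict_mono s \<Longrightarrow> strict_mono t \<Longrightarrow>
    same_qf_type (entry_names C I) R (entry_val f s) R (entry_val f t)"
  shows "indiscernible R C I f"
  unfolding indiscernible_iff_sat
proof (intro ballI allI impI, elim conjE)
  fix \<psi> e and s t :: "nat \<Rightarrow> nat"
  assume \<psi>: "\<psi> \<in> formulas_over (entry_names C I) {}" and st: "strict_mono s" "strict_mono t"
  have "same_qf_type (pars \<psi>) R (entry_val f s) R (entry_val f t)"
    using \<psi> by (intro same_qf_type_subset[OF same_type[OF st]]) (simp add: formulas_over_def)
  then show "sat R (entry_val f s) e \<psi> \<longleftrightarrow> sat R (entry_val f t) e \<psi>"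
    using \<psi> by (intro sat_iff_if_same_qf_type) (simp add: same_qf_type_def free_terms_def formulas_over_def)
qed

lemma indiscernible_if_same_pattern:
  assumes "C \<subseteq> D" and fixes_C: "\<And>l c. c \<in> C \<Longrightarrow> f l c = c"
    and pattern: "\<And>d d' l m l' m'. d \<in> D \<Longrightarrow> d' \<in> D \<Longrightarrow> (l = m \<longleftrightarrow> l' = m') \<Longrightarrow>
      (f l d = f m d' \<longleftrightarrow> f l' d = f m' d') \<and> (R (f l d) (f m d') \<longleftrightarrow> R (f l' d) (f m' d'))"
  shows "indiscernible R C D f"
proof (rule indiscernible_if_same_qf_type)
  fix s t :: "nat \<Rightarrow> nat" assume st: "strict_mono s" "strict_mono t"
  have entry: "\<exists>k. \<exists>d\<in>D. entry_val f s p = f (s k) d \<and> entry_val f t p = f (t k) d"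
    if "p \<in> entry_names C D" for p
    using that unfolding entry_names_def
  proof (elim UnE imageE)
    show ?thesis if "p = Inl c" "c \<in> C" for c
      using that assms(1) fixes_C by (intro exI[of _ 0] bexI[of _ c]) auto
    show ?thesis if "p = Inr q" "q \<in> UNIV \<times> D" for q
      using that by (intro exI[of _ "fst q"] bexI[of _ "snd q"]) auto
  qed
  show "same_qf_type (entry_names C D) R (entry_val f s) R (entry_val f t)"
    unfolding same_qf_type_def
  proof (intro ballI)
    fix p q assume "p \<in> entry_names C D" "q \<in> entry_names C D"
    then obtain k d m d' where d: "d \<in> D" "d' \<in> D"
      and vals: "entry_val f s p = f (s k) d" "entry_val f t p = f (t k) d"
        "entry_val f s q = f (s m) d'" "entry_val f t q = f (t m) d'"
      using entry[of p] entry[of q] by blast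
    have "s k = s m \<longleftrightarrow> t k = t m"
      using st by (simp add: strict_mono_eq)
    then show "(entry_val f s p = entry_val f s q \<longleftrightarrow> entry_val f t p = entry_val f t q) \<and>
        (R (entry_val f s p) (entry_val f s q) \<longleftrightarrow> R (entry_val f t p) (entry_val f t q))"
      unfolding vals by (rule pattern[OF d])
  qed
qed

end

section \<open>The formula does not divide\<close>

lemma transitive_triple_in_semicomplete_digraph:
  assumes "4 \<le> card V" and E: "\<And>u v. u \<in> V \<Longrightarrow> v \<in> V \<Longrightarrow> u \<noteq> v \<Longrightarrow> E u v \<or> E v u"
  shows "\<exists>u\<in>V. \<exists>v\<in>V. \<exists>w\<in>V. E u v \<and> E v w \<and> E u w"
proof -
  have fin: "finite V" "V \<noteq> {}"
    using assms(1) card_ge_0_finite[of V] by auto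
  then obtain u where u: "u \<in> V"
    by blast
  define Out where "Out = {v \<in> V - {u}. E u v}"
  define In where "In = {v \<in> V - {u}. E v u}"
  have "V - {u} \<subseteq> Out \<union> In"
    using E u by (auto simp: Out_def In_def)
  then have "card (V - {u}) \<le> card (Out \<union> In)"
    using fin by (intro card_mono) (auto simp: Out_def In_def)
  also have "\<dots> \<le> card Out + card In"
    by (rule card_Un_le)
  finally have "card V - 1 \<le> card Out + card In"
    using fin u by simp
  then have "\<not> card Out \<le> Suc 0 \<or> \<not> card In \<le> Suc 0"
    using assms(1) by linarith
  moreover have "finite Out" "finite In"
    using fin by (simp_all add: Out_def In_def)
  ultimately consider (outward) v w where "v \<in> Out" "w \<in> Out" "v \<noteq> w"
    | (inward) v w where "v \<in> In" "w \<in> In" "v \<noteq> w"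
    by (auto simp: card_le_Suc0_iff_eq)
  then show ?thesis
  proof cases
    case outward
    then show ?thesis
      using E[of v w] u unfolding Out_def by blast
  next
    case inward
    then show ?thesis
      using E[of v w] u unfolding In_def by blast
  qed
qed

definition independent :: "('a \<Rightarrow> 'a \<Rightarrow> bool) \<Rightarrow> 'a set \<Rightarrow> bool" where
  "independent R I \<longleftrightarrow> (\<forall>x\<in>I. \<forall>y\<in>I. \<not> R x y)"

lemma card_clique_le_if_independent:
  assumes "finite C" "independent R I" and S: "clique R S" "S \<subseteq> C \<union> I"
  shows "card S \<le> Suc (card C)"
proof (cases "S \<subseteq> C")
  case True
  then show ?thesis
    using assms(1) card_mono le_SucI by blast
next
  case False
  then obtain v where "v \<in> S" "v \<in> I"
    using S(2) by auto
  then have "S \<subseteq> insert v C"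
    using assms(2) S unfolding clique_def independent_def by blast
  then have "card S \<le> card (insert v C)"
    using assms(1) by (intro card_mono) auto
  also have "\<dots> \<le> Suc (card C)"
    using assms(1) by (simp add: card_insert_if)
  finally show ?thesis .
qed

lemma (in Kn_free_extension) common_neighbour_of_independent:
  assumes C: "finite C" "card C + 2 < n" and I: "finite I" "independent R I"
  shows "\<exists>x. \<forall>a\<in>C \<union> I. R x a"
proof -
  have "\<exists>x. x \<notin> C \<union> I \<and> (\<forall>a\<in>C \<union> I. R x a \<longleftrightarrow> a \<in> C \<union> I)"
  proof (rule extension)
    show "Suc (card S) \<noteq> n" if "S \<subseteq> C \<union> I" "clique R S" for S
      using card_clique_le_if_independent[OF C(1) I(2) that(2,1)] C(2) by simp
  qed (use C(1) I(1) in simp_all)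
  then show ?thesis
    by blast
qed

context Kn_free_graph
begin

lemma indiscernible_no_transitive_triple:
  assumes C: "finite C" "clique R C" "n = card C + 3"
    and ind: "indiscernible R C I f"
    and joined: "\<And>i c. i \<in> I \<Longrightarrow> c \<in> C \<Longrightarrow> R (f 0 i) c"
    and ijk: "i \<in> I" "j \<in> I" "k \<in> I"
  shows "\<not> (R (f 0 i) (f 1 j) \<and> R (f 0 j) (f 1 k) \<and> R (f 0 i) (f 1 k))"
proof
  assume triple: "R (f 0 i) (f 1 j) \<and> R (f 0 j) (f 1 k) \<and> R (f 0 i) (f 1 k)"
  show False
  proof (rule no_triangle_joined_to_clique[OF C])
    show "R (f 0 i) (f 1 j)"
      using triple by simp
    show "R (f 1 j) (f 2 k)" "R (f 0 i) (f 2 k)"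
      using triple ijk indiscernible_edge_less[OF ind, of j k 0 1 1 2]
        indiscernible_edge_less[OF ind, of i k 0 1 0 2] by simp_all
    show "R (f 0 i) c \<and> R (f 1 j) c \<and> R (f 2 k) c" if "c \<in> C" for c
      using joined[OF _ that] indiscernible_edge_base[OF ind _ that] ijk by blast
  qed
qed

lemma indiscernible_independent_pair:
  assumes C: "finite C" "clique R C" "n = card C + 3"
    and ind: "indiscernible R C I f" and I: "4 \<le> card I"
    and joined: "\<And>i c. i \<in> I \<Longrightarrow> c \<in> C \<Longrightarrow> R (f 0 i) c"
    and independent: "independent R (f 0 ` I)"
  shows "\<exists>i\<in>I. \<exists>j\<in>I. i \<noteq> j \<and> independent R {f l k |l k. k \<in> {i, j}}"
proof -
  define E where "E i j \<longleftrightarrow> R (f 0 i) (f 1 j)" for i j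
  have E: "R (f l i) (f m j) \<longleftrightarrow> E i j" if "i \<in> I" "j \<in> I" "l < m" for l m i j
    unfolding E_def using that by (intro indiscernible_edge_less[OF ind]) auto
  have no_triple: "\<not> (E i j \<and> E j k \<and> E i k)" if "i \<in> I" "j \<in> I" "k \<in> I" for i j k
    unfolding E_def using C ind joined that by (rule indiscernible_no_transitive_triple)
  then obtain i j where ij: "i \<in> I" "j \<in> I" "i \<noteq> j" "\<not> E i j" "\<not> E j i"
    using transitive_triple_in_semicomplete_digraph[OF I, of E] by blast
  have not_E: "\<not> E u v" if "u \<in> {i, j}" "v \<in> {i, j}" for u v
    using that ij no_triple[of u u u] by auto
  have "\<not> R (f l u) (f m v)" if uv: "u \<in> {i, j}" "v \<in> {i, j}" for l m u v
  proof -
    have I: "u \<in> I" "v \<in> I"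
      using uv ij(1,2) by auto
    show ?thesis
    proof (cases l m rule: linorder_cases)
      case less
      then show ?thesis
        using E[OF I] not_E[OF uv] by simp
    next
      case equal
      then show ?thesis
        using indiscernible_edge_same[OF ind I, of l 0] independent I by (simp add: independent_def)
    next
      case greater
      then show ?thesis
        using E[OF I(2,1)] not_E[OF uv(2,1)] sym by blast
    qed
  qed
  then have "independent R {f l k |l k. k \<in> {i, j}}"
    unfolding independent_def by blast
  with ij(1-3) show ?thesis
    by blast
qed

end

lemma sat_phi_if_joined:
  assumes "finite C" and ij: "i \<in> {1..4}" "j \<in> {1..4}" "i \<noteq> j"
    and joined: "\<And>c. c \<in> C \<union> {b i, b j} \<Longrightarrow> R (e 0) c"
  shows "sat R id e (inst b (phi C))"
proof (cases "i < j")
  case True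
  then show ?thesis
    using ij joined by (intro sat_phi[OF assms(1), THEN iffD2] exI[of _ i] exI[of _ j]) auto
next
  case False
  then show ?thesis
    using ij joined by (intro sat_phi[OF assms(1), THEN iffD2] exI[of _ j] exI[of _ i]) auto
qed

context Kn_free_extension
begin

lemma consistent_phi_instances:
  assumes C: "finite C" "card C + 2 < n" and ij: "i \<in> {1..4}" "j \<in> {1..4}" "i \<noteq> j"
    and independent: "independent R {f l k |l k. k \<in> {i, j}}"
  shows "consistent R (\<Union>l. inst (f l) ` {phi C})"
  unfolding consistent_def
proof (intro allI impI)
  fix \<Phi> assume "\<Phi> \<subseteq> (\<Union>l. inst (f l) ` {phi C}) \<and> finite \<Phi>"
  then have "\<Phi> \<subseteq> (\<lambda>l. inst (f l) (phi C)) ` UNIV" "finite \<Phi>"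
    by auto
  then obtain L where L: "finite L" "\<Phi> = (\<lambda>l. inst (f l) (phi C)) ` L"
    by (meson finite_subset_image)
  define I where "I = (\<lambda>(l, k). f l k) ` (L \<times> {i, j})"
  have "I \<subseteq> {f l k |l k. k \<in> {i, j}}"
    by (auto simp: I_def)
  then have "independent R I"
    using independent unfolding independent_def by blast
  moreover have "finite I"
    using L(1) by (simp add: I_def)
  ultimately obtain x where x: "\<And>a. a \<in> C \<union> I \<Longrightarrow> R x a"
    using common_neighbour_of_independent[OF C, of I] by blast
  have "sat R id (\<lambda>_. x) (inst (f l) (phi C))" if "l \<in> L" for l
  proof (rule sat_phi_if_joined[OF C(1) ij])
    show "R x c" if "c \<in> C \<union> {f l i, f l j}" for c
      using that \<open>l \<in> L\<close> by (intro x) (auto simp: I_def)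
  qed
  then show "\<exists>e. \<forall>\<phi>\<in>\<Phi>. sat R id e \<phi>"
    using L(2) by blast
qed

lemma phi_not_divides:
  assumes C: "finite C" "clique R C" "n = card C + 3"
    and joined: "\<And>i c. i \<in> {1..4} \<Longrightarrow> c \<in> C \<Longrightarrow> R (b i) c"
    and independent: "independent R (b ` {1..4})"
  shows "\<not> divides R C {1..4} b {phi C}"
proof -
  have "consistent R (\<Union>l. inst (f l) ` {phi C})"
    if f0: "\<forall>i\<in>{1..4}. f 0 i = b i" and ind: "indiscernible R C {1..4} f" for f
  proof -
    have "f 0 ` {1..4} = b ` {1..4}"
      using f0 by (intro image_cong) auto
    then have "\<exists>i\<in>{1..4}. \<exists>j\<in>{1..4}. i \<noteq> j \<and> independent R {f l k |l k. k \<in> {i, j}}"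
      using f0 joined independent by (intro indiscernible_independent_pair[OF C ind]) simp_all
    then obtain i j where "i \<in> {1..4}" "j \<in> {1..4}" "i \<noteq> j" "independent R {f l k |l k. k \<in> {i, j}}"
      by blast
    then show ?thesis
      using C(3) by (intro consistent_phi_instances[OF C(1)]) simp_all
  qed
  then show ?thesis
    unfolding divides_def by blast
qed

end

section \<open>The formula forks\<close>

lemma complete_type_phi:
  assumes p: "complete_type R D X p" "inst b (phi C) \<in> p"
  shows "\<exists>i\<in>{1..4}. \<exists>j\<in>{1..4}. i \<noteq> j \<and> inst b (phi_pair C i j) \<in> p"
proof -
  have "disj_list (map (inst b) [phi_pair C i j. i \<leftarrow> [1..<5], j \<leftarrow> [Suc i..<5]]) \<in> p"
    using p(2) by (simp add: inst_def phi_def map_pars_disj_list del: upt_rec_numeral upt_Suc)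
  from complete_type_disj_list[OF p(1) this]
  have "\<exists>i\<in>{1..<5}. \<exists>j\<in>{Suc i..<5}. inst b (phi_pair C i j) \<in> p"
    by (simp del: upt_rec_numeral upt_Suc)
  then obtain i j where "i \<in> {1..<5}" "j \<in> {Suc i..<5}" "inst b (phi_pair C i j) \<in> p"
    by blast
  moreover from this have "i \<in> {1..4}" "j \<in> {1..4}" "i \<noteq> j"
    by auto
  ultimately show ?thesis
    by blast
qed

text \<open>
  For non-adjacent \<open>u\<close> and \<open>v\<close> the copies of \<open>u\<close> and \<open>v\<close> span an infinite crown graph, that is, a
  complete bipartite graph minus a perfect matching.
\<close>

definition crown_blowup :: "('a \<Rightarrow> 'a \<Rightarrow> bool) \<Rightarrow> 'a \<Rightarrow> 'a \<Rightarrow> nat \<times> 'a \<Rightarrow> nat \<times> 'a \<Rightarrow> bool" where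
  "crown_blowup R u v = (\<lambda>(l, d) (m, d'). R d d' \<or> {d, d'} = {u, v} \<and> l \<noteq> m)"

lemma clique_crown_blowup_edge:
  assumes S: "clique (crown_blowup R u v) S" and d: "d \<in> snd ` S" "d' \<in> snd ` S" "d \<noteq> d'"
  shows "R d d' \<or> {d, d'} = {u, v}"
proof -
  obtain l m where "(l, d) \<in> S" "(m, d') \<in> S"
    using d(1,2) by auto
  then have "crown_blowup R u v (l, d) (m, d')"
    using S d(3) by (simp add: clique_def)
  then show ?thesis
    by (auto simp: crown_blowup_def)
qed

context Kn_free_graph
begin

lemma snd_neq_if_crown_blowup_edge:
  assumes "u \<noteq> v" "crown_blowup R u v p q"
  shows "snd p \<noteq> snd q"
  using assms irrefl by (cases p; cases q) (auto simp: crown_blowup_def)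

lemma Kn_free_crown_blowup:
  assumes uv: "u \<noteq> v" and C: "finite C" "card C + 2 < n"
    and common: "\<And>d. d \<in> D \<Longrightarrow> R u d \<Longrightarrow> R v d \<Longrightarrow> d \<in> C"
  shows "Kn_free_graph_on n (UNIV \<times> D) (crown_blowup R u v)"
  unfolding Kn_free_graph_on_def
proof (intro conjI notI)
  show "symp_on (UNIV \<times> D) (crown_blowup R u v)"
    using sym by (auto simp: symp_on_def crown_blowup_def)
  show "irreflp_on (UNIV \<times> D) (crown_blowup R u v)"
    using snd_neq_if_crown_blowup_edge[OF uv] by (auto simp: irreflp_on_def)
  assume "\<exists>S\<subseteq>UNIV \<times> D. finite S \<and> card S = n \<and> clique (crown_blowup R u v) S"
  then obtain S where S: "S \<subseteq> UNIV \<times> D" "finite S" "card S = n" "clique (crown_blowup R u v) S"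
    by blast
  have "inj_on snd S"
  proof (rule inj_onI)
    show "p = q" if "p \<in> S" "q \<in> S" "snd p = snd q" for p q
      using S(4) snd_neq_if_crown_blowup_edge[OF uv, of p q] that by (auto simp: clique_def)
  qed
  then have card: "card (snd ` S) = n"
    using S(3) by (simp add: card_image)
  note edge = clique_crown_blowup_edge[OF S(4)]
  show False
  proof (cases "u \<in> snd ` S \<and> v \<in> snd ` S")
    case True
    have "d \<in> C" if "d \<in> snd ` S" "d \<noteq> u" "d \<noteq> v" for d
      using True edge[of u d] edge[of v d] that S(1) by (intro common) (auto simp: doubleton_eq_iff)
    then have "card (snd ` S) \<le> card (insert u (insert v C))"
      using C(1) by (intro card_mono) auto
    also have "\<dots> \<le> card C + 2"
      using C(1) by (simp add: card_insert_if)
    finally show False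
      using C(2) card by simp
  next
    case False
    then have "clique R (snd ` S)"
      using edge unfolding clique_def doubleton_eq_iff by blast
    then show False
      using card_clique_neq card S(2) by blast
  qed
qed

end

definition crown_sequence ::
    "('a \<Rightarrow> 'a \<Rightarrow> bool) \<Rightarrow> 'a set \<Rightarrow> 'a \<Rightarrow> 'a \<Rightarrow> (nat \<Rightarrow> 'a \<Rightarrow> 'a) \<Rightarrow> bool" where
  "crown_sequence R D u v f \<longleftrightarrow> (\<forall>d\<in>D. f 0 d = d) \<and> (\<forall>d\<in>D. \<forall>d'\<in>D. \<forall>l m.
    (f l d = f m d' \<longleftrightarrow> d = d' \<and> (l = m \<or> d \<notin> {u, v})) \<and>
    (R (f l d) (f m d') \<longleftrightarrow> R d d' \<or> {d, d'} = {u, v} \<and> l \<noteq> m))"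

lemma crown_sequence_fixes:
  assumes "crown_sequence R D u v f" "d \<in> D - {u, v}"
  shows "f l d = d"
proof -
  have "f l d = f 0 d"
    using assms unfolding crown_sequence_def by blast
  then show ?thesis
    using assms by (simp add: crown_sequence_def)
qed

context Kn_free_extension
begin

lemma ex_crown_sequence:
  assumes D: "finite D" "u \<noteq> v" and C: "finite C" "card C + 2 < n"
    and common: "\<And>d. d \<in> D \<Longrightarrow> R u d \<Longrightarrow> R v d \<Longrightarrow> d \<in> C"
  shows "\<exists>f. crown_sequence R D u v f"
proof -
  have "countable (UNIV \<times> D :: (nat \<times> 'a) set)"
    using D(1) by (simp add: countable_finite)
  moreover have "same_qf_type ({0} \<times> D) (crown_blowup R u v) id R snd"
    by (auto simp: same_qf_type_def crown_blowup_def)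
  ultimately obtain z where z: "\<And>p. p \<in> {0} \<times> D \<Longrightarrow> z p = snd p"
      "same_qf_type (UNIV \<times> D) (crown_blowup R u v) id R z"
    using embedding_extends_to_countable[OF Kn_free_crown_blowup[OF D(2) C common], of D "{0} \<times> D" snd] D(1)
    by auto
  define copy where "copy l d = (if d \<in> {u, v} then l else 0, d)" for l :: nat and d
  have "z (copy 0 d) = d" if "d \<in> D" for d
    using z(1)[of "(0, d)"] that by (simp add: copy_def)
  moreover have "(z (copy l d) = z (copy m d') \<longleftrightarrow> d = d' \<and> (l = m \<or> d \<notin> {u, v})) \<and>
      (R (z (copy l d)) (z (copy m d')) \<longleftrightarrow> R d d' \<or> {d, d'} = {u, v} \<and> l \<noteq> m)"
    if "d \<in> D" "d' \<in> D" for d d' l m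
  proof -
    have "copy l d \<in> UNIV \<times> D" "copy m d' \<in> UNIV \<times> D"
      using that by (simp_all add: copy_def)
    from same_qf_type_eq_iff[OF z(2) this] same_qf_type_edge_iff[OF z(2) this]
    show ?thesis
      by (auto simp: copy_def crown_blowup_def doubleton_eq_iff)
  qed
  ultimately have "crown_sequence R D u v (\<lambda>l d. z (copy l d))"
    by (simp add: crown_sequence_def)
  then show ?thesis
    by blast
qed

lemma indiscernible_crown_sequence:
  assumes f: "crown_sequence R D u v f" and C: "C \<subseteq> D - {u, v}"
  shows "indiscernible R C D f"
proof (rule indiscernible_if_same_pattern)
  show "C \<subseteq> D"
    using C by blast
  show "f l c = c" if "c \<in> C" for l c
    using crown_sequence_fixes[OF f] C that by blast
qed (use f in \<open>simp add: crown_sequence_def\<close>)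

lemma crown_sequence_no_common_neighbour:
  assumes C: "finite C" "clique R C" "n = card C + 3" "C \<subseteq> D - {u, v}"
    and uv: "u \<in> D" "v \<in> D" and f: "crown_sequence R D u v f"
    and joined: "\<And>c. c \<in> C \<Longrightarrow> R u c \<and> R v c"
    and x: "\<And>d. d \<in> C \<union> {u, v} \<Longrightarrow> R x (f 0 d) \<and> R x (f 1 d)"
  shows False
proof (rule no_triangle_joined_to_clique[OF C(1-3)])
  have edge: "R (f l d) (f m d') \<longleftrightarrow> R d d' \<or> {d, d'} = {u, v} \<and> l \<noteq> m"
    if "d \<in> D" "d' \<in> D" for l m d d'
    using f that by (simp add: crown_sequence_def)
  show "R x (f 0 u)" "R x (f 1 v)" "R (f 0 u) (f 1 v)"
    using x edge uv by auto
  fix c assume c: "c \<in> C"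
  then have "R (f 0 u) (f 0 c)" "R (f 1 v) (f 0 c)"
    using edge joined uv C(4) by blast+
  moreover have "f 0 c = c"
    using crown_sequence_fixes[OF f] c C(4) by blast
  ultimately show "R x c \<and> R (f 0 u) c \<and> R (f 1 v) c"
    using x[of c] c by simp
qed

lemma divides_if_joined_to_pair:
  assumes C: "finite C" "clique R C" "n = card C + 3" and D: "finite D" "C \<subseteq> D"
    and uv: "u \<in> D - C" "v \<in> D - C" "u \<noteq> v"
    and common: "\<And>d. d \<in> D \<Longrightarrow> R u d \<and> R v d \<longleftrightarrow> d \<in> C"
    and \<theta>: "\<theta> \<in> \<pi>" "\<And>\<rho> e c. sat R \<rho> e \<theta> \<Longrightarrow> c \<in> C \<union> {u, v} \<Longrightarrow> R (e 0) (\<rho> c)"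
  shows "divides R C D (\<lambda>d. d) (map_pars Inr ` \<pi>)"
proof -
  obtain f where f: "crown_sequence R D u v f"
    using ex_crown_sequence[OF D(1) uv(3) C(1)] C(3) common by auto
  have C_sub: "C \<subseteq> D - {u, v}"
    using D(2) uv(1,2) by blast
  have "\<not> consistent R (\<Union>l. inst (f l) ` map_pars Inr ` \<pi>)"
  proof
    assume cons: "consistent R (\<Union>l. inst (f l) ` map_pars Inr ` \<pi>)"
    let ?F = "{inst (f 0) (map_pars Inr \<theta>), inst (f 1) (map_pars Inr \<theta>)}"
    have "?F \<subseteq> (\<Union>l. inst (f l) ` map_pars Inr ` \<pi>)" "finite ?F"
      using \<theta>(1) by auto
    then obtain e where "\<forall>\<phi>\<in>?F. sat R id e \<phi>"
      using cons unfolding consistent_def by blast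
    then have "sat R (f 0) e \<theta>" "sat R (f 1) e \<theta>"
      by (simp_all add: sat_inst sat_map_pars comp_def)
    then have "R (e 0) (f 0 c) \<and> R (e 0) (f 1 c)" if "c \<in> C \<union> {u, v}" for c
      using \<theta>(2) that by blast
    then show False
      using crown_sequence_no_common_neighbour[OF C C_sub _ _ f] uv(1,2) D(2) common by blast
  qed
  moreover have "indiscernible R C D f" "\<forall>d\<in>D. f 0 d = d"
    using indiscernible_crown_sequence[OF f C_sub] f by (simp_all add: crown_sequence_def)
  ultimately show ?thesis
    unfolding divides_def by blast
qed

lemma phi_forks:
  assumes C: "finite C" "clique R C" "n = card C + 3"
    and inj: "inj_on b {1..4}"
    and joined: "\<And>i c. i \<in> {1..4} \<Longrightarrow> c \<in> C \<Longrightarrow> R (b i) c"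
    and independent: "independent R (b ` {1..4})"
    and \<kappa>: "(natLeq, \<kappa>) \<in> ordLess"
  shows "forks R \<kappa> C {0} {1..4} b {phi C}"
proof -
  define D where "D = b ` {1..4} \<union> C"
  have D: "finite D" "C \<subseteq> D"
    using C(1) by (auto simp: D_def)
  have "divides R C D (\<lambda>d. d) (map_pars Inr ` p)"
    if p: "complete_type R D {0} p" "inst b ` {phi C} \<subseteq> p" for p
  proof -
    obtain i j where ij: "i \<in> {1..4}" "j \<in> {1..4}" "i \<noteq> j" and \<theta>: "inst b (phi_pair C i j) \<in> p"
      using complete_type_phi[OF p(1), of b C] p(2) by blast
    have "b k \<notin> C" if "k \<in> {1..4}" for k
      using joined[OF that] irrefl by blast
    then have neighbours: "b k \<in> D - C" "d \<in> D \<Longrightarrow> R (b k) d \<longleftrightarrow> d \<in> C" if "k \<in> {1..4}" for k d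
      using that joined independent by (auto simp: D_def independent_def)
    show ?thesis
    proof (rule divides_if_joined_to_pair[OF C D _ _ _ _ \<theta>])
      show "b i \<noteq> b j"
        using inj ij by (auto simp: inj_on_def)
      show "R (e 0) (\<rho> c)" if "sat R \<rho> e (inst b (phi_pair C i j))" "c \<in> C \<union> {b i, b j}" for \<rho> e c
        using that C(1) by (auto simp: sat_inst phi_pair_def sat_conj_set)
    qed (use neighbours ij in auto)
  qed
  moreover have "small \<kappa> D"
    using \<kappa> D(1) ordLess_transitive unfolding small_def finite_iff_ordLess_natLeq by blast
  ultimately show ?thesis
    unfolding forks_def D_def by blast
qed

end

theorem theorem6p2:
  fixes n :: nat
    and H :: "nat \<Rightarrow> nat \<Rightarrow> bool"
    and R :: "'a \<Rightarrow> 'a \<Rightarrow> bool"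
    and \<kappa> :: "'k rel"
    and C :: "'a set"
    and b :: "nat \<Rightarrow> 'a"
  assumes "n \<ge> 3"
    and "generic_Kn_free_graph n H"
    and "monster_model \<kappa> (theory_of H) R"
    and "finite C"
    and "inj_on b {1..4}"
    and "card C = n - 3"
    and "clique R C"
    and "\<forall>i\<in>{1..4}. \<forall>c\<in>C. R (b i) c"
    and "\<forall>i\<in>{1..4}. \<forall>j\<in>{1..4}. \<not> R (b i) (b j)"
  shows "forks R \<kappa> C {0} {1..4} b {phi C} \<and> \<not> divides R C {1..4} b {phi C}"
proof -
  have R: "models R (theory_of H)" and \<kappa>: "(natLeq, \<kappa>) \<in> ordLess"
    using assms(3) by (simp_all add: monster_model_def)
  interpret Kn_free_extension n R
    using Kn_free_extension_if_generic[OF assms(2)] R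
    by (rule Kn_free_extension_if_elementarily_equivalent)
  have "n = card C + 3" "independent R (b ` {1..4})"
    using assms(1,6,9) by (simp_all add: independent_def)
  then show ?thesis
    using phi_forks[OF assms(4,7) _ assms(5) _ _ \<kappa>] phi_not_divides[OF assms(4,7)] assms(8) by blast
qed

end
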